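(* Let $k$ be a positive real number. The generating function $f_k(x)=\sum_{i=0}^{\infty} f_{k,i}x^{i}$ of the falling $k$-binomial transform $(f_{k,n})_{n\ge 0}$ of the modified $k$-Fibonacci-like sequence is, as a formal power series in $x$, $$f_{k}(x) = \frac{2+(2-4k)x}{1-3kx+(2k^{2}-1)x^{2}}.$$
   Context: For a positive real number $k$, the modified $k$-Fibonacci-like sequence $(M_{k,n})_{n\ge 0}$ is defined by $M_{k,0}=M_{k,1}=2$ and $M_{k,n+1}=kM_{k,n}+M_{k,n-1}$ for $n\ge 1$. Its falling $k$-binomial transform $(f_{k,n})_{n\ge 0}$ is defined by $f_{k,n}=\sum_{i=0}^{n}\binom{n}{i}k^{n-i}M_{k,i}$. *)

theory Defs
  imports Complex_Main "HOL-Computational_Algebra.Formal_Power_Series"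
begin

fun mod_fib_like :: "real \<Rightarrow> nat \<Rightarrow> real" where
  "mod_fib_like k 0 = 2"
| "mod_fib_like k (Suc 0) = 2"
| "mod_fib_like k (Suc (Suc n)) = k * mod_fib_like k (Suc n) + mod_fib_like k n"

definition falling_binomial_transform :: "real \<Rightarrow> (nat \<Rightarrow> real) \<Rightarrow> nat \<Rightarrow> real" where
  "falling_binomial_transform k a n = (\<Sum>i=0..n. of_nat (n choose i) * k ^ (n - i) * a i)"

end

theory Submission
  imports Defs
begin

text \<open>
  Write \<open>T\<close> for the falling \<open>k\<close>-binomial transform on sequences and \<open>S\<close> for the shift. Pascal's rule
  gives the commutation relation \<open>S T = T (S + k)\<close>, that is \<open>T S = (S - k) T\<close>. The sequence
  \<open>M\<close> is annihilated by \<open>S\<^sup>2 - k S - 1\<close>, hence \<open>T M\<close> is annihilated by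
  \<open>(S - k)\<^sup>2 - k (S - k) - 1 = S\<^sup>2 - 3 k S + (2 k\<^sup>2 - 1)\<close>. The reciprocal polynomial of this operator
  is the denominator of the generating function; the numerator is determined by the two initial
  values \<open>2\<close> and \<open>2 k + 2\<close> of the transform.
\<close>

text \<open>
  Pascal's rule: the subsets of an \<open>(n+1)\<close>-set avoiding a fixed element contribute a factor
  \<open>k\<close>, those containing it contribute a shift of the sequence.
\<close>
lemma falling_binomial_transform_Suc:
  "falling_binomial_transform k a (Suc n) =
     k * falling_binomial_transform k a n + falling_binomial_transform k (\<lambda>i. a (Suc i)) n"
proof -
  have avoid: "(\<Sum>i=0..Suc n. of_nat (n choose i) * k ^ (Suc n - i) * a i) =
      k * falling_binomial_transform k a n"
    by (simp add: falling_binomial_transform_def sum_distrib_left Suc_diff_le mult_ac)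
  have "falling_binomial_transform k a (Suc n) =
      k ^ Suc n * a 0 +
      (\<Sum>i=0..n. of_nat (Suc n choose Suc i) * k ^ (n - i) * a (Suc i))"
    unfolding falling_binomial_transform_def
    by (subst sum.atLeast0_atMost_Suc_shift) simp
  also have "\<dots> = k ^ Suc n * a 0 +
      (\<Sum>i=0..n. of_nat (n choose Suc i) * k ^ (n - i) * a (Suc i)) +
      falling_binomial_transform k (\<lambda>i. a (Suc i)) n"
    by (simp add: falling_binomial_transform_def sum.distrib algebra_simps)
  also have "k ^ Suc n * a 0 + (\<Sum>i=0..n. of_nat (n choose Suc i) * k ^ (n - i) * a (Suc i)) =
      (\<Sum>i=0..Suc n. of_nat (n choose i) * k ^ (Suc n - i) * a i)"
    by (subst sum.atLeast0_atMost_Suc_shift) simp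
  finally show ?thesis
    by (simp only: avoid)
qed

lemma falling_binomial_transform_linear:
  "falling_binomial_transform k (\<lambda>i. c * a i + b i) n =
     c * falling_binomial_transform k a n + falling_binomial_transform k b n"
  by (simp add: falling_binomial_transform_def sum_distrib_left sum.distrib algebra_simps)

lemma falling_binomial_transform_mod_fib_like_rec:
  fixes k :: real
  defines "f \<equiv> falling_binomial_transform k (mod_fib_like k)"
  shows "f (Suc (Suc n)) = 3 * k * f (Suc n) - (2 * k ^ 2 - 1) * f n"
proof -
  define g where "g = falling_binomial_transform k (\<lambda>i. mod_fib_like k (Suc i))"
  have f_Suc: "f (Suc m) = k * f m + g m" for m
    by (simp add: f_def g_def falling_binomial_transform_Suc)
  have "g (Suc m) = k * g m + (k * g m + f m)" for m
    by (simp add: f_def g_def falling_binomial_transform_Suc falling_binomial_transform_linear)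
  then show ?thesis
    by (simp add: f_Suc algebra_simps power2_eq_square)
qed

text \<open>
  The coefficient of \<open>X\<^sup>n\<^sup>+\<^sup>2\<close> in the product is the recurrence read at \<open>n\<close>; only the two
  lowest coefficients survive in the numerator.
\<close>
lemma fps_mult_recurrence_polynomial:
  fixes f :: "nat \<Rightarrow> 'a :: comm_ring_1"
  assumes "\<And>n. f (Suc (Suc n)) = p * f (Suc n) - q * f n"
  shows "Abs_fps f * (1 - fps_const p * fps_X + fps_const q * fps_X ^ 2) =
    fps_const (f 0) + fps_const (f 1 - p * f 0) * fps_X"
proof (rule fps_ext)
  fix n
  have expand: "Abs_fps f * (1 - fps_const p * fps_X + fps_const q * fps_X ^ 2) =
      Abs_fps f - fps_const p * (fps_X * Abs_fps f)
        + fps_const q * (fps_X * (fps_X * Abs_fps f))"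
    by (simp add: algebra_simps power2_eq_square)
  consider "n = 0" | "n = 1" | m where "n = Suc (Suc m)"
    by (metis One_nat_def not0_implies_Suc)
  then show "fps_nth (Abs_fps f * (1 - fps_const p * fps_X + fps_const q * fps_X ^ 2)) n =
      fps_nth (fps_const (f 0) + fps_const (f 1 - p * f 0) * fps_X) n"
    unfolding expand by cases (simp_all add: assms)
qed

theorem mainTheorem12:
  fixes k :: real
  assumes "k > 0"
  shows "Abs_fps (falling_binomial_transform k (mod_fib_like k)) =
    (fps_const 2 + fps_const (2 - 4 * k) * fps_X) /
    (1 - fps_const (3 * k) * fps_X + fps_const (2 * k ^ 2 - 1) * fps_X ^ 2)"
    (is "?F = ?N / ?D")
proof -
  have initial: "falling_binomial_transform k (mod_fib_like k) 0 = 2"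
      "falling_binomial_transform k (mod_fib_like k) 1 - 3 * k * 2 = 2 - 4 * k"
    by (simp_all add: falling_binomial_transform_def)
  have "?F * ?D = ?N"
    using fps_mult_recurrence_polynomial[of "falling_binomial_transform k (mod_fib_like k)",
        OF falling_binomial_transform_mod_fib_like_rec]
    by (simp only: initial)
  moreover have "?D \<noteq> 0"
  proof
    assume "?D = 0"
    then have "fps_nth ?D 0 = 0"
      by (simp only: fps_zero_nth)
    then show False
      by simp
  qed
  ultimately show ?thesis
    by (metis nonzero_mult_div_cancel_right)
qed

end
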